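(* For any odd prime $p$ and positive integers $n,s,t$ with $s\ge 2$, $t\ge 2$ and $n\ge s+t+1$, there exists a regular $3$-polytope of order $2^np$ with Schläfli type $\{2^sp,2^t\}$.
   Context: A string C-group of rank $3$ is a pair $(G,\{\rho_0,\rho_1,\rho_2\})$ where $G$ is a group generated by the ordered set of involutions $\rho_0,\rho_1,\rho_2$ such that $\rho_0\rho_2=\rho_2\rho_0$ (string property) and, writing $G_I=\langle \rho_i : i\in I\rangle$, one has $G_I\cap G_J=G_{I\cap J}$ for all $I,J\subseteq\{0,1,2\}$ (intersection property). Its order is $|G|$ and its (Schläfli) type is $\{o(\rho_0\rho_1),o(\rho_1\rho_2)\}$, an ordered pair. Abstract regular $3$-polytopes and string C-groups of rank $3$ are the same objects: the automorphism group of a regular $3$-polytope $\mathcal P$, with the distinguished generators attached to a flag, is a string C-group of rank $3$, and conversely every string C-group of rank $3$ is the automorphism group of a regular $3$-polytope; the order and type of $\mathcal P$ are those of the string C-group. *)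

theory Defs
  imports "HOL-Algebra.Algebra" "HOL-Computational_Algebra.Primes"
begin

text \<open>
  Regular 3-polytopes are treated as string C-groups of rank 3: the automorphism group of a
  regular 3-polytope with the distinguished generators attached to a flag is such a group, and
  conversely.  The generators are \<open>\<rho> 0\<close>, \<open>\<rho> 1\<close>, \<open>\<rho> 2\<close>; the values of \<open>\<rho>\<close> at other indices are
  irrelevant.  The intersection property forces the three generators to be distinct.
\<close>

locale string_C_group_rank3 = group G for G (structure) +
  fixes \<rho> :: "nat \<Rightarrow> 'a"
  assumes rho_closed: "i \<in> {0, 1, 2} \<Longrightarrow> \<rho> i \<in> carrier G"
    and involution: "i \<in> {0, 1, 2} \<Longrightarrow> \<rho> i \<noteq> \<one> \<and> \<rho> i \<otimes> \<rho> i = \<one>"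
    and generated: "generate G (\<rho> ` {0, 1, 2}) = carrier G"
    and string_property: "\<rho> 0 \<otimes> \<rho> 2 = \<rho> 2 \<otimes> \<rho> 0"
    and intersection_property: "\<lbrakk>I \<subseteq> {0, 1, 2}; J \<subseteq> {0, 1, 2}\<rbrakk> \<Longrightarrow>
      generate G (\<rho> ` I) \<inter> generate G (\<rho> ` J) = generate G (\<rho> ` (I \<inter> J))"

definition schlaefli_type :: "('a, 'b) monoid_scheme \<Rightarrow> (nat \<Rightarrow> 'a) \<Rightarrow> nat \<times> nat" where
  "schlaefli_type G \<rho> =
    (group.ord G (\<rho> 0 \<otimes>\<^bsub>G\<^esub> \<rho> 1), group.ord G (\<rho> 1 \<otimes>\<^bsub>G\<^esub> \<rho> 2))"

end

theory Submission imports Defs begin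

text \<open>
  Idea.  Let \<open>K = 2^s p\<close> and \<open>L = 2^t\<close>.  Mix three reflection triples: one generating a dihedral
  group of order \<open>2 K\<close> in which \<open>\<rho> 2\<close> acts trivially, one generating a dihedral group of order \<open>2 L\<close>
  in which \<open>\<rho> 0\<close> acts trivially, and one coming from a toroidal map of type \<open>{4,4}\<close>.  In the
  generated group \<open>G\<close> the first projection kills \<open>\<rho> 2\<close> and is faithful on \<open>\<langle>\<rho> 0, \<rho> 1\<rangle>\<close>, and this alone
  forces the intersection property.  Let \<open>T\<close> be the subgroup generated by the conjugates of
  \<open>(\<rho> 0 \<rho> 1 \<rho> 2 \<rho> 1)\<^sup>2\<close>, which consists of translations of the torus.  Modulo \<open>T\<close> every element of \<open>G\<close>
  factors as \<open>(\<rho> 0 \<rho> 1)^i s\<close> with \<open>i < K\<close> and \<open>s\<close> in the dihedral group \<open>\<langle>\<rho> 1, \<rho> 2\<rangle>\<close>, uniquely because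
  the two dihedral projections kill \<open>T\<close>.  Hence \<open>|G| = 2 K L |T|\<close>, and the torus can be chosen
  so that \<open>|T|\<close> is any prescribed power of \<open>2\<close>.
\<close>

section \<open>Groups generated by involutions\<close>

context group
begin

lemma involution_inv:
  assumes "x \<in> carrier G" "x \<otimes> x = \<one>"
  shows "inv x = x"
  using assms by (simp add: inv_equality)

lemma generate_left_induct [consumes 3, case_names one mult]:
  assumes S: "S \<subseteq> carrier G" "\<forall>x\<in>S. x \<otimes> x = \<one>"
    and x: "x \<in> generate G S"
    and one: "P \<one>"
    and mult: "\<And>a y. a \<in> S \<Longrightarrow> y \<in> generate G S \<Longrightarrow> P y \<Longrightarrow> P (a \<otimes> y)"
  shows "P x"
proof -
  \<comment> \<open>Prepending \<open>x\<close> to an arbitrary \<open>y\<close> copes with the rule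
    \<open>eng\<close>, which splits a product anywhere and not after one letter.\<close>
  have "\<forall>y \<in> generate G S. P y \<longrightarrow> P (x \<otimes> y)"
    using x
  proof (induction rule: generate.induct)
    case one
    then show ?case using generate_in_carrier[OF S(1)] by simp
  next
    case (incl h)
    then show ?case using mult by blast
  next
    case (inv h)
    then have "inv h = h" using S involution_inv by auto
    then show ?case using inv mult by metis
  next
    case (eng h1 h2)
    show ?case
    proof (intro ballI impI)
      fix y assume y: "y \<in> generate G S" "P y"
      have "h2 \<otimes> y \<in> generate G S" using eng.hyps(2) y(1) by (rule generate.eng)
      with eng.IH y have "P (h1 \<otimes> (h2 \<otimes> y))" by blast
      then show "P (h1 \<otimes> h2 \<otimes> y)"
        using eng.hyps y generate_in_carrier[OF S(1)] by (simp add: m_assoc)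
    qed
  qed
  then have "P (x \<otimes> \<one>)" using one generate.one by blast
  then show ?thesis using x generate_in_carrier[OF S(1)] by simp
qed

lemma generate_right_induct [consumes 3, case_names one mult]:
  assumes S: "S \<subseteq> carrier G" "\<forall>x\<in>S. x \<otimes> x = \<one>"
    and x: "x \<in> generate G S"
    and one: "P \<one>"
    and mult: "\<And>a y. a \<in> S \<Longrightarrow> y \<in> generate G S \<Longrightarrow> P y \<Longrightarrow> P (y \<otimes> a)"
  shows "P x"
proof -
  note cl = generate_in_carrier[OF S(1)]
  \<comment> \<open>Inversion reverses words, so left induction for \<open>P (inv z)\<close> is
    right induction for \<open>P\<close>.\<close>
  have "P (inv z)" if "z \<in> generate G S" for z
    using S that
  proof (induction rule: generate_left_induct)
    case one
    then show ?case using assms(4) by simp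
  next
    case (mult a y)
    have a: "a \<in> carrier G" "inv a = a" using mult S involution_inv by auto
    have "inv y \<in> generate G S" using S(1) mult(2) by (rule generate_m_inv_closed)
    then have "P (inv y \<otimes> a)" using mult assms(5) by blast
    then show ?case using a mult cl by (simp add: inv_mult_group)
  qed
  then have "P (inv (inv x))" using S(1) x by (meson generate_m_inv_closed)
  then show ?thesis using cl[OF x] by simp
qed

text \<open>With \<open>r = a \<otimes> b\<close>, right multiplication by \<open>a\<close> or
  \<open>b\<close> preserves the two forms, because \<open>a = r \<otimes> b\<close> and
  \<open>b \<otimes> a = inv r\<close>.\<close>

lemma dihedral_cases:
  assumes "x \<in> generate G {a, b}" "a \<in> carrier G" "b \<in> carrier G" "a \<otimes> a = \<one>" "b \<otimes> b = \<one>"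
  obtains i :: int where "x = (a \<otimes> b) [^] i" | i :: int where "x = (a \<otimes> b) [^] i \<otimes> b"
proof -
  note ab = assms(2,3)
  have sub: "{a, b} \<subseteq> carrier G" and sq: "\<forall>y\<in>{a, b}. y \<otimes> y = \<one>" using assms by auto
  have "(\<exists>i::int. x = (a \<otimes> b) [^] i) \<or> (\<exists>i::int. x = (a \<otimes> b) [^] i \<otimes> b)"
    using sub sq assms(1)
  proof (induction rule: generate_right_induct)
    case one
    have "\<one> = (a \<otimes> b) [^] (0::int)" by simp
    then show ?case by blast
  next
    case (mult c y)
    let ?r = "a \<otimes> b"
    have r: "?r \<in> carrier G" and a: "a = ?r \<otimes> b" and b: "inv ?r = b \<otimes> a"
      using ab assms(4,5) by (simp_all add: m_assoc inv_mult_group involution_inv)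
    from mult(3) obtain i :: int where i: "y = ?r [^] i \<or> y = ?r [^] i \<otimes> b" by blast
    have "?r [^] i \<otimes> a = ?r [^] (i + 1) \<otimes> b"
      using r ab a by (simp add: int_pow_mult m_assoc)
    moreover have "?r [^] i \<otimes> b \<otimes> a = ?r [^] (i + - 1)"
      using r ab b int_pow_mult[OF r, of i "- 1"] int_pow_neg[OF r, of 1] by (simp add: m_assoc)
    moreover have "?r [^] i \<otimes> b \<otimes> b = ?r [^] i"
      using r ab assms(5) by (simp add: m_assoc)
    ultimately show ?case using mult(1) i by (elim insertE disjE emptyE) auto
  qed
  then show thesis using that by blast
qed

text \<open>A power of \<open>a \<otimes> b\<close> commutes with \<open>a \<otimes> b\<close>,
  whereas conjugation by \<open>b\<close> inverts it. Used contrapositively: when the rotation does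
  not square to \<open>\<one>\<close>, reflections are not rotations.\<close>

lemma reflection_not_rotation:
  assumes "a \<in> carrier G" "b \<in> carrier G" "a \<otimes> a = \<one>" "b \<otimes> b = \<one>"
    and "b = (a \<otimes> b) [^] (i::int)"
  shows "(a \<otimes> b) \<otimes> (a \<otimes> b) = \<one>"
proof -
  have "b \<otimes> (a \<otimes> b) = (a \<otimes> b) \<otimes> b"
    using assms(1,2) int_pow_mult[of "a \<otimes> b" i 1] int_pow_mult[of "a \<otimes> b" 1 i]
    by (subst (1 4) assms(5)) (simp add: add.commute)
  then have "b \<otimes> (a \<otimes> b) = a" using assms by (simp add: m_assoc)
  then show ?thesis using assms by (simp add: m_assoc)
qed

lemma ord_gt_2D:
  assumes "x \<in> carrier G" "ord x > 2"
  shows "x \<otimes> x \<noteq> \<one>"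
proof
  assume "x \<otimes> x = \<one>"
  then have "x [^] (2::nat) = \<one>" using assms(1) by (simp add: numeral_2_eq_2)
  then have "ord x dvd 2" using assms(1) by (simp add: pow_eq_id)
  then show False using assms(2) by (auto dest: dvd_imp_le)
qed

text \<open>\<open>ord\<close> is 0 for elements of infinite order, so \<open>ord x > 0\<close>
  expresses finite order.\<close>

lemma int_pow_reduce:
  assumes "x \<in> carrier G" "ord x > 0"
  shows "\<exists>j < ord x. x [^] (i::int) = x [^] j"
proof (intro exI conjI)
  show "nat (i mod ord x) < ord x" using assms(2) by (simp add: nat_less_iff)
  have "x [^] i = x [^] (i mod ord x)"
    using assms(1) by (simp add: int_pow_eq mod_eq_dvd_iff[symmetric])
  then show "x [^] i = x [^] nat (i mod ord x)"
    using assms(2) by (metis int_pow_int nat_0_le of_nat_0_less_iff pos_mod_sign)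
qed

text \<open>Counts the forms \<open>r^i\<close> and \<open>r^i b\<close> with \<open>i\<close> below
  the order of \<open>r\<close>; they are distinct because \<open>b\<close> is not a power of
  \<open>r\<close> once this order exceeds 2.\<close>

lemma card_dihedral:
  assumes ab: "a \<in> carrier G" "b \<in> carrier G" "a \<otimes> a = \<one>" "b \<otimes> b = \<one>"
    and ord: "ord (a \<otimes> b) > 2"
  shows "card (generate G {a, b}) = 2 * ord (a \<otimes> b)" "finite (generate G {a, b})"
proof -
  let ?r = "a \<otimes> b" and ?n = "ord (a \<otimes> b)"
  define h where "h = (\<lambda>(i, e). ?r [^] (i::nat) \<otimes> (if e then b else \<one>))"
  have r: "?r \<in> carrier G" using ab by simp
  have n: "?n \<noteq> 0" using ord by simp
  have nt: "b \<noteq> ?r [^] (i::int)" for i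
    using reflection_not_rotation[OF ab] ord_gt_2D[OF r ord] by blast
  have red: "\<exists>j<?n. ?r [^] i = ?r [^] j" for i :: int using int_pow_reduce[OF r] n by simp
  have "generate G {a, b} = h ` ({..<?n} \<times> UNIV)"
  proof (intro equalityI subsetI)
    fix x assume x: "x \<in> generate G {a, b}"
    show "x \<in> h ` ({..<?n} \<times> UNIV)"
    proof (cases rule: dihedral_cases[OF x ab])
      case (1 i)
      obtain j where "?r [^] i = ?r [^] j" "j < ?n" using red[of i] by blast
      then have "x = h (j, False)" "j < ?n" using 1 r by (simp_all add: h_def)
      then show ?thesis by blast
    next
      case (2 i)
      obtain j where "?r [^] i = ?r [^] j" "j < ?n" using red[of i] by blast
      then have "x = h (j, True)" "j < ?n" using 2 r by (simp_all add: h_def)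
      then show ?thesis by blast
    qed
  next
    fix x assume "x \<in> h ` ({..<?n} \<times> UNIV)"
    then obtain i e where x: "x = h (i, e)" by auto
    have sg: "subgroup (generate G {a, b}) G" using ab by (simp add: generate_is_subgroup)
    have "a \<in> generate G {a, b}" "b \<in> generate G {a, b}" by (auto intro: generate.incl)
    then have "?r [^] i \<in> generate G {a, b}" "(if e then b else \<one>) \<in> generate G {a, b}"
      using subgroup_int_pow_closed[OF sg, of ?r "int i"]
      by (auto simp: int_pow_int intro: generate.one generate.eng)
    then show "x \<in> generate G {a, b}" using x by (auto simp: h_def intro: generate.eng)
  qed
  moreover have "inj_on h ({..<?n} \<times> UNIV)"
  proof (rule inj_onI)
    fix x y assume xy: "x \<in> {..<?n} \<times> UNIV" "y \<in> {..<?n} \<times> UNIV" "h x = h y"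
    obtain i e j f where e: "x = (i, e)" "y = (j, f)" by fastforce
    have eq: "?r [^] i \<otimes> (if e then b else \<one>) = ?r [^] j \<otimes> (if f then b else \<one>)"
      using xy(3) e by (simp add: h_def)
    have no: False if "?r [^] k \<otimes> b = ?r [^] l" for k l :: nat
    proof -
      have "b = inv (?r [^] k) \<otimes> ?r [^] l" using that r ab by (metis inv_solve_left nat_pow_closed)
      also have "\<dots> = ?r [^] (- int k + int l)"
        using r int_pow_mult[OF r, of "- int k" "int l"] by (simp add: int_pow_neg int_pow_int)
      finally show False using nt by blast
    qed
    have ef: "e = f" using eq no[of i j] no[of j i] r by (cases e; cases f) auto
    then have "?r [^] i = ?r [^] j" using eq r ab by (simp split: if_splits)
    then have "i = j"
      using ord_inj[OF r] xy(1,2) e unfolding inj_on_def by fastforce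
    then show "x = y" using e ef by simp
  qed
  ultimately show "card (generate G {a, b}) = 2 * ?n" "finite (generate G {a, b})"
    by (simp_all add: card_image card_cartesian_product)
qed

end

section \<open>The intersection property from one dihedral quotient\<close>

text \<open>The part of the string C-group axioms that holds by construction of the group; the
  intersection property is obtained later from a quotient.\<close>

locale string_reflections = group G for G (structure) +
  fixes \<rho> :: "nat \<Rightarrow> 'a"
  assumes rho_closed: "i \<in> {0, 1, 2} \<Longrightarrow> \<rho> i \<in> carrier G"
    and rho_square: "i \<in> {0, 1, 2} \<Longrightarrow> \<rho> i \<otimes> \<rho> i = \<one>"
    and generated: "generate G (\<rho> ` {0, 1, 2}) = carrier G"
    and string_property: "\<rho> 0 \<otimes> \<rho> 2 = \<rho> 2 \<otimes> \<rho> 0"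
begin

text \<open>The simp rules write the index 1 as \<open>Suc 0\<close>, the form to which simp
  normalises it.\<close>

lemma rho_in_carrier [simp]: "\<rho> 0 \<in> carrier G" "\<rho> (Suc 0) \<in> carrier G" "\<rho> 2 \<in> carrier G"
  using rho_closed by auto

lemma rho_squares [simp]: "\<rho> 0 \<otimes> \<rho> 0 = \<one>" "\<rho> (Suc 0) \<otimes> \<rho> (Suc 0) = \<one>" "\<rho> 2 \<otimes> \<rho> 2 = \<one>"
  using rho_square by auto

lemma rho_cancel [simp]:
  assumes "x \<in> carrier G"
  shows "\<rho> 0 \<otimes> (\<rho> 0 \<otimes> x) = x" "\<rho> (Suc 0) \<otimes> (\<rho> (Suc 0) \<otimes> x) = x" "\<rho> 2 \<otimes> (\<rho> 2 \<otimes> x) = x"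
  using assms by (simp_all flip: m_assoc)

lemma inv_rho [simp]: "inv \<rho> 0 = \<rho> 0" "inv \<rho> (Suc 0) = \<rho> (Suc 0)" "inv \<rho> 2 = \<rho> 2"
  by (simp_all add: involution_inv)

lemma generate_pair_closed: "x \<in> generate G {\<rho> i, \<rho> j} \<Longrightarrow> i \<in> {0,1,2} \<Longrightarrow> j \<in> {0,1,2} \<Longrightarrow> x \<in> carrier G"
  using generate_in_carrier[of "{\<rho> i, \<rho> j}" x] rho_closed by auto

lemma generate_commuting:
  "generate G {\<rho> 0, \<rho> 2} = {\<one>, \<rho> 0, \<rho> 2, \<rho> 0 \<otimes> \<rho> 2}"
proof
  show "generate G {\<rho> 0, \<rho> 2} \<subseteq> {\<one>, \<rho> 0, \<rho> 2, \<rho> 0 \<otimes> \<rho> 2}"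
  proof
    fix x assume x: "x \<in> generate G {\<rho> 0, \<rho> 2}"
    have "{\<rho> 0, \<rho> 2} \<subseteq> carrier G" "\<forall>x\<in>{\<rho> 0, \<rho> 2}. x \<otimes> x = \<one>" by auto
    then show "x \<in> {\<one>, \<rho> 0, \<rho> 2, \<rho> 0 \<otimes> \<rho> 2}" using x
    proof (induction rule: generate_left_induct)
      case one
      then show ?case by simp
    next
      case (mult a y)
      have "\<rho> 2 \<otimes> (\<rho> 0 \<otimes> \<rho> 2) = \<rho> 0" by (simp add: string_property)
      then show ?case using mult(1,3) by (auto simp flip: string_property)
    qed
  qed
qed (auto intro: generate.intros)

end

locale split_string_reflections = string_reflections + f: group_hom G A f for A (structure) and f +
  assumes f_rho2: "f (\<rho> 2) = \<one>\<^bsub>A\<^esub>"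
    and rho2_nontrivial: "\<rho> 2 \<noteq> \<one>"
    and ord_f: "group.ord A (f (\<rho> 0 \<otimes> \<rho> 1)) = ord (\<rho> 0 \<otimes> \<rho> 1)"
    and ord_gt_2: "ord (\<rho> 0 \<otimes> \<rho> 1) > 2"
begin

lemma f_sq: "f (\<rho> 0) \<otimes>\<^bsub>A\<^esub> f (\<rho> 0) = \<one>\<^bsub>A\<^esub>" "f (\<rho> (Suc 0)) \<otimes>\<^bsub>A\<^esub> f (\<rho> (Suc 0)) = \<one>\<^bsub>A\<^esub>"
  by (simp_all flip: f.hom_mult)

lemma f_rotation_sq: "f (\<rho> 0 \<otimes> \<rho> 1) \<otimes>\<^bsub>A\<^esub> f (\<rho> 0 \<otimes> \<rho> 1) \<noteq> \<one>\<^bsub>A\<^esub>"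
  using f.H.ord_gt_2D[of "f (\<rho> 0 \<otimes> \<rho> 1)"] ord_f ord_gt_2 by simp

text \<open>Since \<open>f\<close> kills \<open>\<rho> 2\<close>, the image of this subgroup is
  generated by \<open>f (\<rho> 1)\<close> alone, whose square is trivial.\<close>

lemma f_generate_12: "x \<in> generate G {\<rho> 1, \<rho> 2} \<Longrightarrow> f x = \<one>\<^bsub>A\<^esub> \<or> f x = f (\<rho> 1)"
proof -
  assume x: "x \<in> generate G {\<rho> 1, \<rho> 2}"
  have S: "{\<rho> 1, \<rho> 2} \<subseteq> carrier G" "\<forall>x\<in>{\<rho> 1, \<rho> 2}. x \<otimes> x = \<one>" by auto
  show ?thesis using S x
  proof (induction rule: generate_left_induct)
    case one
    then show ?case by simp
  next
    case (mult a y)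
    have "y \<in> carrier G" using mult(2) S(1) generate_in_carrier by blast
    then show ?case using mult(1,3) f_sq f_rho2 by auto
  qed
qed

text \<open>Equal orders make \<open>f\<close> injective on rotations, and reflections cannot map to
  rotations because \<open>f (\<rho> 0 \<otimes> \<rho> 1)\<close> does not square to the identity.
  With \<open>f_generate_12\<close> this bounds the intersection of the two dihedral
  subgroups.\<close>

lemma f_faithful_01:
  assumes x: "x \<in> generate G {\<rho> 0, \<rho> 1}"
  shows "f x = \<one>\<^bsub>A\<^esub> \<Longrightarrow> x = \<one>" "f x = f (\<rho> 1) \<Longrightarrow> x = \<rho> 1"
proof -
  let ?r = "\<rho> 0 \<otimes> \<rho> 1"
  have r: "?r \<in> carrier G" by simp
  have faith: "?r [^] i = \<one>" if "f ?r [^]\<^bsub>A\<^esub> i = \<one>\<^bsub>A\<^esub>" for i :: int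
    using that f.H.int_pow_eq_id[of "f ?r" i] int_pow_eq_id[OF r, of i] ord_f by simp
  have nt: "f (\<rho> 1) \<noteq> f ?r [^]\<^bsub>A\<^esub> i" for i :: int
  proof
    assume "f (\<rho> 1) = f ?r [^]\<^bsub>A\<^esub> i"
    then have "f ?r \<otimes>\<^bsub>A\<^esub> f ?r = \<one>\<^bsub>A\<^esub>"
      using f.H.reflection_not_rotation[of "f (\<rho> 0)" "f (\<rho> 1)" i] f_sq by simp
    then show False using f_rotation_sq by simp
  qed
  have "(f x = \<one>\<^bsub>A\<^esub> \<longrightarrow> x = \<one>) \<and> (f x = f (\<rho> 1) \<longrightarrow> x = \<rho> 1)"
  proof (cases rule: dihedral_cases[OF x])
    \<comment> \<open>Cases 1 to 4 are the remaining side conditions of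
      \<open>dihedral_cases\<close>, left to the closing \<open>simp_all\<close>; 5 and 6 are
      rotations and reflections.\<close>
    case (5 i)
    then have "f x = f ?r [^]\<^bsub>A\<^esub> i" using f.hom_int_pow[OF r] by simp
    then show ?thesis using 5 faith nt by metis
  next
    case (6 i)
    then have fx: "f x = f ?r [^]\<^bsub>A\<^esub> i \<otimes>\<^bsub>A\<^esub> f (\<rho> 1)" using f.hom_int_pow[OF r] by simp
    have "f x \<noteq> \<one>\<^bsub>A\<^esub>"
    proof
      assume "f x = \<one>\<^bsub>A\<^esub>"
      then have "f (\<rho> 1) = inv\<^bsub>A\<^esub> (f ?r [^]\<^bsub>A\<^esub> i)"
        using fx by (metis One_nat_def rho_in_carrier(2) f.H.int_pow_closed f.H.inv_equality f.H.inv_inv f.hom_closed r f.H.inv_closed f_sq(2) f.H.inv_comm)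
      then show False using nt[of "- i"] r by (simp add: f.H.int_pow_neg del: f.hom_mult)
    qed
    moreover have "x = \<rho> 1" if "f x = f (\<rho> 1)"
    proof -
      have "f ?r [^]\<^bsub>A\<^esub> i = \<one>\<^bsub>A\<^esub>"
        using that fx by (metis One_nat_def rho_in_carrier(2) f.H.int_pow_closed f.H.r_cancel_one' f.hom_closed r)
      then show ?thesis using 6 faith by simp
    qed
    ultimately show ?thesis by blast
  qed simp_all
  then show "f x = \<one>\<^bsub>A\<^esub> \<Longrightarrow> x = \<one>" "f x = f (\<rho> 1) \<Longrightarrow> x = \<rho> 1" by auto
qed

lemma generate_01_12: "x \<in> generate G {\<rho> 0, \<rho> 1} \<Longrightarrow> x \<in> generate G {\<rho> 1, \<rho> 2} \<Longrightarrow> x \<in> {\<one>, \<rho> 1}"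
  using f_faithful_01 f_generate_12 by blast

lemma f_nontrivial: "f (\<rho> 0) \<noteq> \<one>\<^bsub>A\<^esub>" "f (\<rho> 1) \<noteq> \<one>\<^bsub>A\<^esub>" "f (\<rho> 0) \<noteq> f (\<rho> 1)"
  using f_rotation_sq f_sq by auto

text \<open>Independence of the generators. It settles the intersections with the four-element
  subgroup of \<open>\<rho> 0\<close> and \<open>\<rho> 2\<close>: any larger intersection would put
  a generator into the subgroup of the other two.\<close>

lemma rho_outside:
  "\<rho> 0 \<notin> generate G {\<rho> 1, \<rho> 2}" "\<rho> 1 \<notin> generate G {\<rho> 0, \<rho> 2}" "\<rho> 2 \<notin> generate G {\<rho> 0, \<rho> 1}"
proof -
  show "\<rho> 0 \<notin> generate G {\<rho> 1, \<rho> 2}"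
    using f_generate_12 f_nontrivial by auto
  show "\<rho> 2 \<notin> generate G {\<rho> 0, \<rho> 1}"
    using f_faithful_01(1) f_rho2 rho2_nontrivial by blast
  have "f (\<rho> 0 \<otimes> \<rho> 2) = f (\<rho> 0)" using f_rho2 by simp
  then have "\<rho> 1 \<noteq> \<rho> 0 \<otimes> \<rho> 2" using f_nontrivial by auto
  moreover have "\<rho> 1 \<noteq> \<one>" "\<rho> 1 \<noteq> \<rho> 0" "\<rho> 1 \<noteq> \<rho> 2" using f_nontrivial f_rho2 by auto
  ultimately show "\<rho> 1 \<notin> generate G {\<rho> 0, \<rho> 2}" unfolding generate_commuting by blast
qed

lemma generate_01_02: "x \<in> generate G {\<rho> 0, \<rho> 1} \<Longrightarrow> x \<in> generate G {\<rho> 0, \<rho> 2} \<Longrightarrow> x \<in> {\<one>, \<rho> 0}"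
proof -
  assume x: "x \<in> generate G {\<rho> 0, \<rho> 1}" "x \<in> generate G {\<rho> 0, \<rho> 2}"
  have "\<rho> 0 \<in> generate G {\<rho> 0, \<rho> 1}" by (auto intro: generate.incl)
  then have "\<rho> 0 \<otimes> x \<in> generate G {\<rho> 0, \<rho> 1}" using x(1) by (rule generate.eng)
  then have "x \<noteq> \<rho> 2" "x \<noteq> \<rho> 0 \<otimes> \<rho> 2" using x(1) rho_outside(3) by auto
  then show ?thesis using x(2) unfolding generate_commuting by blast
qed

lemma generate_02_12: "x \<in> generate G {\<rho> 0, \<rho> 2} \<Longrightarrow> x \<in> generate G {\<rho> 1, \<rho> 2} \<Longrightarrow> x \<in> {\<one>, \<rho> 2}"
proof -
  assume x: "x \<in> generate G {\<rho> 0, \<rho> 2}" "x \<in> generate G {\<rho> 1, \<rho> 2}"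
  have "\<rho> 2 \<in> generate G {\<rho> 1, \<rho> 2}" by (auto intro: generate.incl)
  with x(2) have "x \<otimes> \<rho> 2 \<in> generate G {\<rho> 1, \<rho> 2}" by (rule generate.eng)
  then have "x \<noteq> \<rho> 0" "x \<noteq> \<rho> 0 \<otimes> \<rho> 2" using x(2) rho_outside(1) by (auto simp: m_assoc)
  then show ?thesis using x(1) unfolding generate_commuting by blast
qed

lemma rho_distinct: "\<rho> 0 \<noteq> \<rho> 1" "\<rho> 0 \<noteq> \<rho> 2" "\<rho> 1 \<noteq> \<rho> 2" "\<rho> 0 \<noteq> \<one>" "\<rho> 1 \<noteq> \<one>"
  using f_nontrivial f_rho2 by auto

text \<open>In this form the intersection property becomes propositional: the conditions for
  \<open>I \<inter> J\<close> are those for \<open>I\<close> together with those for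
  \<open>J\<close>.\<close>

lemma generate_iff:
  assumes "I \<subseteq> {0, 1, 2}"
  shows "x \<in> generate G (\<rho> ` I) \<longleftrightarrow> x \<in> carrier G \<and>
    (0 \<in> I \<or> x \<in> generate G {\<rho> 1, \<rho> 2}) \<and> (1 \<in> I \<or> x \<in> generate G {\<rho> 0, \<rho> 2}) \<and>
    (2 \<in> I \<or> x \<in> generate G {\<rho> 0, \<rho> 1})" (is "_ \<longleftrightarrow> ?R")
proof
  assume x: "x \<in> generate G (\<rho> ` I)"
  have "x \<in> carrier G" using x generate_in_carrier[of "\<rho> ` I"] assms rho_closed by blast
  moreover have "x \<in> generate G {\<rho> 1, \<rho> 2}" if "0 \<notin> I"
  proof -
    have "\<rho> ` I \<subseteq> {\<rho> 1, \<rho> 2}" using that assms by blast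
    then show ?thesis using x mono_generate by blast
  qed
  moreover have "x \<in> generate G {\<rho> 0, \<rho> 2}" if "1 \<notin> I"
  proof -
    have "\<rho> ` I \<subseteq> {\<rho> 0, \<rho> 2}" using that assms by blast
    then show ?thesis using x mono_generate by blast
  qed
  moreover have "x \<in> generate G {\<rho> 0, \<rho> 1}" if "2 \<notin> I"
  proof -
    have "\<rho> ` I \<subseteq> {\<rho> 0, \<rho> 1}" using that assms by blast
    then show ?thesis using x mono_generate by blast
  qed
  ultimately show ?R by blast
next
  assume R: ?R
  have 1: "\<one> \<in> generate G (\<rho> ` I)" by (rule generate.one)
  have incl: "\<rho> i \<in> generate G (\<rho> ` I)" if "i \<in> I" for i using that by (blast intro: generate.incl)
  show "x \<in> generate G (\<rho> ` I)"
  proof (cases "0 \<in> I"; cases "1 \<in> I"; cases "2 \<in> I")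
    assume a: "0 \<in> I" "1 \<in> I" "2 \<in> I"
    then have "I = {0, 1, 2}" using assms by blast
    then show ?thesis using R generated by simp
  next
    assume a: "0 \<in> I" "1 \<in> I" "2 \<notin> I"
    then have "\<rho> ` I = {\<rho> 0, \<rho> 1}" using assms by blast
    then show ?thesis using a R by simp
  next
    assume a: "0 \<in> I" "1 \<notin> I" "2 \<in> I"
    then have "\<rho> ` I = {\<rho> 0, \<rho> 2}" using assms by blast
    then show ?thesis using a R by simp
  next
    assume a: "0 \<notin> I" "1 \<in> I" "2 \<in> I"
    then have "\<rho> ` I = {\<rho> 1, \<rho> 2}" using assms by blast
    then show ?thesis using a R by simp
  next
    assume "0 \<in> I" "1 \<notin> I" "2 \<notin> I"
    then show ?thesis using generate_01_02[of x] R 1 incl[of 0] by blast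
  next
    assume "0 \<notin> I" "1 \<in> I" "2 \<notin> I"
    then show ?thesis using generate_01_12[of x] R 1 incl[of 1] by blast
  next
    assume "0 \<notin> I" "1 \<notin> I" "2 \<in> I"
    then show ?thesis using generate_02_12[of x] R 1 incl[of 2] by blast
  next
    assume "0 \<notin> I" "1 \<notin> I" "2 \<notin> I"
    then have "x \<in> {\<one>, \<rho> 1}" "x \<in> {\<one>, \<rho> 0}"
      using R generate_01_12[of x] generate_01_02[of x] by blast+
    then have "x = \<one>" using rho_distinct(1) by auto
    then show ?thesis using 1 by simp
  qed
qed

lemma intersection:
  assumes "I \<subseteq> {0, 1, 2}" "J \<subseteq> {0, 1, 2}"
  shows "generate G (\<rho> ` I) \<inter> generate G (\<rho> ` J) = generate G (\<rho> ` (I \<inter> J))"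
proof (rule Set.set_eqI)
  fix x
  have IJ: "I \<inter> J \<subseteq> {0, 1, 2}" using assms by blast
  show "x \<in> generate G (\<rho> ` I) \<inter> generate G (\<rho> ` J) \<longleftrightarrow> x \<in> generate G (\<rho> ` (I \<inter> J))"
    unfolding Int_iff generate_iff[OF assms(1)] generate_iff[OF assms(2)] generate_iff[OF IJ] by blast
qed

lemma string_C_group: "string_C_group_rank3 G \<rho>"
proof
  show "\<rho> i \<noteq> \<one> \<and> \<rho> i \<otimes> \<rho> i = \<one>" if "i \<in> {0, 1, 2}" for i
    using that rho_distinct rho2_nontrivial rho_square by auto
qed (use rho_closed generated string_property intersection in auto)

end

section \<open>The order formula\<close>

text \<open>\<open>T_translation\<close> says that the involutions \<open>\<rho> 0\<close> and
  \<open>\<rho> 1 \<otimes> \<rho> 2 \<otimes> \<rho> 1\<close> commute modulo \<open>T\<close>,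
  which bounds the order from above. The maps \<open>f\<close> and \<open>g\<close>, both trivial on
  \<open>T\<close>, give the matching lower bound.\<close>

locale tight_kernel = split_string_reflections G \<rho> A f + g: group_hom G B g
  for G (structure) and \<rho> A f B g +
  fixes T
  assumes T_normal: "T \<lhd> G"
    and T_finite: "finite T"
    and f_T: "x \<in> T \<Longrightarrow> f x = \<one>\<^bsub>A\<^esub>"
    and g_T: "x \<in> T \<Longrightarrow> g x = \<one>\<^bsub>B\<^esub>"
    and ord_g: "group.ord B (g (\<rho> 1 \<otimes> \<rho> 2)) = ord (\<rho> 1 \<otimes> \<rho> 2)"
    and ord_12_gt_2: "ord (\<rho> 1 \<otimes> \<rho> 2) > 2"
    and T_translation: "(\<rho> 0 \<otimes> \<rho> 1 \<otimes> \<rho> 2 \<otimes> \<rho> 1) \<otimes> (\<rho> 0 \<otimes> \<rho> 1 \<otimes> \<rho> 2 \<otimes> \<rho> 1) \<in> T"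
begin

lemma T_subgroup: "subgroup T G"
  using T_normal by (rule normal_imp_subgroup)

lemmas T_closed = subgroup.mem_carrier[OF T_subgroup]
  and T_mult = subgroup.m_closed[OF T_subgroup]
  and T_inv = subgroup.m_inv_closed[OF T_subgroup]
  and T_one = subgroup.one_closed[OF T_subgroup]

lemma T_conj: "x \<in> T \<Longrightarrow> i \<in> {0, 1, 2} \<Longrightarrow> \<rho> i \<otimes> x \<otimes> \<rho> i \<in> T"
  using normal.inv_op_closed2[OF T_normal rho_closed[of i], of x] involution_inv[OF rho_closed[of i] rho_square[of i]]
  by simp

text \<open>Equal orders handle rotations; a reflection in the kernel would make
  \<open>g (\<rho> 2)\<close> a power of the image rotation, whose order exceeds 2.\<close>

lemma g_faithful_12:
  assumes x: "x \<in> generate G {\<rho> 1, \<rho> 2}" and gx: "g x = \<one>\<^bsub>B\<^esub>"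
  shows "x = \<one>"
proof -
  let ?r = "\<rho> 1 \<otimes> \<rho> 2"
  have r: "?r \<in> carrier G" by simp
  have sq: "g (\<rho> 1) \<otimes>\<^bsub>B\<^esub> g (\<rho> 1) = \<one>\<^bsub>B\<^esub>" "g (\<rho> 2) \<otimes>\<^bsub>B\<^esub> g (\<rho> 2) = \<one>\<^bsub>B\<^esub>"
    by (simp_all flip: g.hom_mult)
  show ?thesis
  proof (cases rule: dihedral_cases[OF x])
    case (5 i)
    then have "g ?r [^]\<^bsub>B\<^esub> i = \<one>\<^bsub>B\<^esub>" using gx g.hom_int_pow[OF r] by simp
    then show ?thesis
      using 5 g.H.int_pow_eq_id[of "g ?r" i] int_pow_eq_id[OF r, of i] ord_g by simp
  next
    case (6 i)
    then have "g ?r [^]\<^bsub>B\<^esub> i \<otimes>\<^bsub>B\<^esub> g (\<rho> 2) = \<one>\<^bsub>B\<^esub>" using gx g.hom_int_pow[OF r] by simp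
    then have "g (\<rho> 2) = inv\<^bsub>B\<^esub> (g ?r [^]\<^bsub>B\<^esub> i)"
      by (metis rho_in_carrier(3) g.H.int_pow_closed g.H.inv_equality g.hom_closed r g.H.inv_comm)
    then have "g (\<rho> 2) = g ?r [^]\<^bsub>B\<^esub> (- i)"
      using r by (simp add: g.H.int_pow_neg del: g.hom_mult)
    then have "g ?r \<otimes>\<^bsub>B\<^esub> g ?r = \<one>\<^bsub>B\<^esub>"
      using g.H.reflection_not_rotation[of "g (\<rho> 1)" "g (\<rho> 2)" "- i"] sq by simp
    then show ?thesis using g.H.ord_gt_2D[of "g ?r"] ord_g ord_12_gt_2 by simp
  qed simp_all
qed

text \<open>Modulo \<open>T\<close>, the conjugates \<open>\<rho> 2\<close> and \<open>\<rho> 1 \<otimes> \<rho> 2 \<otimes> \<rho> 1\<close> commute with \<open>\<rho> 0\<close>, so they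
  can be moved to the right past any word in \<open>\<rho> 0\<close>, \<open>\<rho> 1\<close>.\<close>

lemma move_right:
  assumes x: "x \<in> generate G {\<rho> 0, \<rho> 1}"
  shows "(\<exists>t\<in>T. \<exists>s\<in>generate G {\<rho> 1, \<rho> 2}. \<rho> 2 \<otimes> x = t \<otimes> x \<otimes> s) \<and>
    (\<exists>t\<in>T. \<exists>s\<in>generate G {\<rho> 1, \<rho> 2}. \<rho> 1 \<otimes> \<rho> 2 \<otimes> \<rho> 1 \<otimes> x = t \<otimes> x \<otimes> s)"
proof -
  let ?D = "generate G {\<rho> 1, \<rho> 2}" and ?c = "\<rho> 1 \<otimes> \<rho> 2 \<otimes> \<rho> 1"
  have D: "\<rho> 1 \<in> ?D" "\<rho> 2 \<in> ?D" by (auto intro: generate.incl)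
  have Dc: "s \<in> carrier G" if "s \<in> ?D" for s using that generate_pair_closed by auto
  have S: "{\<rho> 0, \<rho> 1} \<subseteq> carrier G" "\<forall>x\<in>{\<rho> 0, \<rho> 1}. x \<otimes> x = \<one>" by auto
  show ?thesis using S x
  proof (induction rule: generate_left_induct)
    case one
    have "\<rho> 2 \<otimes> \<one> = \<one> \<otimes> \<one> \<otimes> \<rho> 2" "?c \<otimes> \<one> = \<one> \<otimes> \<one> \<otimes> ?c" by simp_all
    moreover have "?c \<in> ?D" using D generate.eng by metis
    ultimately show ?case using D T_one by blast
  next
    case (mult a y)
    have y: "y \<in> carrier G" using mult(2) S(1) generate_in_carrier by blast
    from mult(3) obtain t s t' s' where
      t: "t \<in> T" "s \<in> ?D" "\<rho> 2 \<otimes> y = t \<otimes> y \<otimes> s" and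
      t': "t' \<in> T" "s' \<in> ?D" "?c \<otimes> y = t' \<otimes> y \<otimes> s'" by blast
    note cl = y T_closed[OF t(1)] T_closed[OF t'(1)] Dc[OF t(2)] Dc[OF t'(2)]
    from mult(1) consider "a = \<rho> 0" | "a = \<rho> 1" by blast
    then show ?case
    proof cases
      case 1
      have "\<rho> 2 \<otimes> (\<rho> 0 \<otimes> y) = \<rho> 0 \<otimes> (\<rho> 2 \<otimes> y)"
        using y by (simp add: string_property flip: m_assoc)
      also have "\<dots> = (\<rho> 0 \<otimes> t \<otimes> \<rho> 0) \<otimes> (\<rho> 0 \<otimes> y) \<otimes> s"
        unfolding t(3) using cl by (simp add: m_assoc)
      finally have A: "\<exists>t\<in>T. \<exists>s\<in>?D. \<rho> 2 \<otimes> (\<rho> 0 \<otimes> y) = t \<otimes> (\<rho> 0 \<otimes> y) \<otimes> s"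
        using T_conj[OF t(1), of 0] t(2) by blast
      \<comment> \<open>\<open>u\<close> is the commutator of \<open>?c\<close> and
        \<open>\<rho> 0\<close>, so that
        \<open>?c \<otimes> \<rho> 0 = u \<otimes> \<rho> 0 \<otimes> ?c\<close>.\<close>
      define u where "u = inv ((\<rho> 0 \<otimes> \<rho> 1 \<otimes> \<rho> 2 \<otimes> \<rho> 1) \<otimes> (\<rho> 0 \<otimes> \<rho> 1 \<otimes> \<rho> 2 \<otimes> \<rho> 1))"
      have u: "u \<in> T" unfolding u_def using T_translation by (rule T_inv)
      have "?c \<otimes> (\<rho> 0 \<otimes> y) = u \<otimes> (\<rho> 0 \<otimes> (?c \<otimes> y))"
        unfolding u_def using y by (simp add: inv_mult_group m_assoc)
      also have "\<dots> = u \<otimes> (\<rho> 0 \<otimes> t' \<otimes> \<rho> 0) \<otimes> (\<rho> 0 \<otimes> y) \<otimes> s'"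
        unfolding t'(3) using cl T_closed[OF u] by (simp add: m_assoc)
      finally have "\<exists>t\<in>T. \<exists>s\<in>?D. ?c \<otimes> (\<rho> 0 \<otimes> y) = t \<otimes> (\<rho> 0 \<otimes> y) \<otimes> s"
        using T_mult[OF u T_conj[OF t'(1), of 0]] t'(2) by blast
      with A 1 show ?thesis by blast
    next
      case 2
      \<comment> \<open>Passing \<open>\<rho> 1\<close> exchanges \<open>\<rho> 2\<close> and
        \<open>?c\<close>, which is why both claims share one induction.\<close>
      have "\<rho> 2 \<otimes> (\<rho> 1 \<otimes> y) = \<rho> 1 \<otimes> (?c \<otimes> y)"
        using y by (simp add: m_assoc)
      also have "\<dots> = (\<rho> 1 \<otimes> t' \<otimes> \<rho> 1) \<otimes> (\<rho> 1 \<otimes> y) \<otimes> s'"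
        unfolding t'(3) using cl by (simp add: m_assoc)
      finally have A: "\<exists>t\<in>T. \<exists>s\<in>?D. \<rho> 2 \<otimes> (\<rho> 1 \<otimes> y) = t \<otimes> (\<rho> 1 \<otimes> y) \<otimes> s"
        using T_conj[OF t'(1), of 1] t'(2) by blast
      have "?c \<otimes> (\<rho> 1 \<otimes> y) = \<rho> 1 \<otimes> (\<rho> 2 \<otimes> y)"
        using y by (simp add: m_assoc)
      also have "\<dots> = (\<rho> 1 \<otimes> t \<otimes> \<rho> 1) \<otimes> (\<rho> 1 \<otimes> y) \<otimes> s"
        unfolding t(3) using cl by (simp add: m_assoc)
      finally have "\<exists>t\<in>T. \<exists>s\<in>?D. ?c \<otimes> (\<rho> 1 \<otimes> y) = t \<otimes> (\<rho> 1 \<otimes> y) \<otimes> s"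
        using T_conj[OF t(1), of 1] t(2) by blast
      with A 2 show ?thesis by blast
    qed
  qed
qed

text \<open>A new letter on the left conjugates \<open>t\<close> within \<open>T\<close>;
  \<open>\<rho> 0\<close> and \<open>\<rho> 1\<close> then join \<open>d\<close>, while
  \<open>\<rho> 2\<close> passes \<open>d\<close> by \<open>move_right\<close> and joins
  \<open>s\<close>.\<close>

lemma factorization:
  assumes "x \<in> carrier G"
  shows "\<exists>t\<in>T. \<exists>d\<in>generate G {\<rho> 0, \<rho> 1}. \<exists>s\<in>generate G {\<rho> 1, \<rho> 2}. x = t \<otimes> d \<otimes> s"
proof -
  let ?E = "generate G {\<rho> 0, \<rho> 1}" and ?D = "generate G {\<rho> 1, \<rho> 2}"
  have E: "\<rho> 0 \<in> ?E" "\<rho> 1 \<in> ?E" by (auto intro: generate.incl)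
  have cl: "s \<in> carrier G" if "s \<in> ?D \<or> s \<in> ?E" for s using that generate_pair_closed by auto
  have S: "\<rho> ` {0, 1, 2} \<subseteq> carrier G" "\<forall>x\<in>\<rho> ` {0, 1, 2}. x \<otimes> x = \<one>" by auto
  have "x \<in> generate G (\<rho> ` {0, 1, 2})" using assms generated by simp
  with S show ?thesis
  proof (induction rule: generate_left_induct)
    case one
    have "\<one> = \<one> \<otimes> \<one> \<otimes> \<one>" by simp
    then show ?case using T_one generate.one by meson
  next
    case (mult a y)
    from mult(3) obtain t d s where y: "t \<in> T" "d \<in> ?E" "s \<in> ?D" "y = t \<otimes> d \<otimes> s" by blast
    from mult(1) obtain i where i: "i \<in> {0, 1, 2}" "a = \<rho> i" by blast
    have ac: "a \<in> carrier G" "a \<otimes> a = \<one>" using i rho_closed rho_square by auto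
    have tc: "t \<in> carrier G" "d \<in> carrier G" "s \<in> carrier G" using y T_closed cl by auto
    have c: "a \<otimes> t \<otimes> a \<in> T" using T_conj[OF y(1) i(1)] i(2) by simp
    have "a \<otimes> (a \<otimes> z) = z" if "z \<in> carrier G" for z
      using that ac by (simp flip: m_assoc)
    then have eq: "a \<otimes> y = (a \<otimes> t \<otimes> a) \<otimes> (a \<otimes> d) \<otimes> s"
      unfolding y(4) using ac tc by (simp add: m_assoc)
    show ?case
    proof (cases "i = 2")
      case False
      then have "a \<in> ?E" using i E by auto
      then have "a \<otimes> d \<in> ?E" using y(2) by (rule generate.eng)
      then show ?thesis using eq c y(3) by blast
    next
      case True
      then obtain u s' where u: "u \<in> T" "s' \<in> ?D" "a \<otimes> d = u \<otimes> d \<otimes> s'"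
        using move_right[OF y(2)] i by blast
      have uc: "u \<in> carrier G" "s' \<in> carrier G" using u T_closed cl by auto
      have "a \<otimes> y = ((a \<otimes> t \<otimes> a) \<otimes> u) \<otimes> d \<otimes> (s' \<otimes> s)"
        unfolding eq u(3) using ac tc uc by (simp add: m_assoc)
      then show ?thesis using T_mult[OF c u(1)] y(2) generate.eng[OF u(2) y(3)] by blast
    qed
  qed
qed

text \<open>The triples \<open>(t, i, s)\<close> parametrise the group: \<open>factorization\<close>
  gives existence; for uniqueness \<open>f\<close> determines \<open>i\<close>, then
  \<open>g\<close> determines \<open>s\<close>, and \<open>t\<close> follows by
  cancellation.\<close>

lemma order: "order G = 2 * ord (\<rho> 0 \<otimes> \<rho> 1) * ord (\<rho> 1 \<otimes> \<rho> 2) * card T"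
  and finite_carrier: "finite (carrier G)"
proof -
  let ?r = "\<rho> 0 \<otimes> \<rho> 1" and ?D = "generate G {\<rho> 1, \<rho> 2}"
  let ?K = "ord (\<rho> 0 \<otimes> \<rho> 1)"
  let ?S = "T \<times> {..<?K} \<times> ?D"
  define h where "h = (\<lambda>(t, i :: nat, s). t \<otimes> ?r [^] i \<otimes> s)"
  have r: "?r \<in> carrier G" by simp
  have K: "?K \<noteq> 0" using ord_gt_2 by simp
  have Dc: "s \<in> carrier G" if "s \<in> ?D" for s using that generate_pair_closed by auto
  have D1: "\<rho> 1 \<in> ?D" by (auto intro: generate.incl)
  have D: "card ?D = 2 * ord (\<rho> 1 \<otimes> \<rho> 2)" "finite ?D"
    using card_dihedral[of "\<rho> 1" "\<rho> 2"] ord_12_gt_2 by simp_all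
  have red: "\<exists>j<?K. ?r [^] i = ?r [^] j" for i :: int using int_pow_reduce[OF r] K by simp
  have "carrier G = h ` ?S"
  proof (intro equalityI subsetI)
    fix x assume "x \<in> carrier G"
    then obtain t d s where x: "t \<in> T" "d \<in> generate G {\<rho> 0, \<rho> 1}" "s \<in> ?D" "x = t \<otimes> d \<otimes> s"
      using factorization by blast
    note tc = T_closed[OF x(1)] Dc[OF x(3)]
    show "x \<in> h ` ?S"
    proof (cases rule: dihedral_cases[OF x(2)])
      case (5 i)
      then obtain j where "j < ?K" "d = ?r [^] j" using red by metis
      then have "x = h (t, j, s)" "(t, j, s) \<in> ?S" using x by (auto simp: h_def)
      then show ?thesis by blast
    next
      case (6 i)
      \<comment> \<open>The trailing \<open>\<rho> 1\<close> of a reflection is absorbed by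
        \<open>s\<close>, so powers of \<open>?r\<close> suffice in the middle.\<close>
      then obtain j where "j < ?K" "d = ?r [^] j \<otimes> \<rho> 1" using red by metis
      then have "x = h (t, j, \<rho> 1 \<otimes> s)" "(t, j, \<rho> 1 \<otimes> s) \<in> ?S"
        using x tc generate.eng[OF D1 x(3)] r by (auto simp: h_def m_assoc)
      then show ?thesis by blast
    qed simp_all
  next
    fix x assume "x \<in> h ` ?S"
    then show "x \<in> carrier G" using T_closed Dc r by (auto simp: h_def)
  qed
  moreover have "inj_on h ?S"
  proof (rule inj_onI)
    fix x y assume xy: "x \<in> ?S" "y \<in> ?S" "h x = h y"
    obtain t i s t' i' s' where e: "x = (t, i, s)" "y = (t', i', s')" by (metis prod_cases3)
    have m: "t \<in> T" "t' \<in> T" "i < ?K" "i' < ?K" "s \<in> ?D" "s' \<in> ?D" using xy e by auto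
    note c = T_closed[OF m(1)] T_closed[OF m(2)] Dc[OF m(5)] Dc[OF m(6)]
    have eq: "t \<otimes> ?r [^] i \<otimes> s = t' \<otimes> ?r [^] i' \<otimes> s'"
      using xy(3) e by (simp add: h_def)
    define k where "k = int i - int i'"
    have rk: "?r [^] k = inv (?r [^] i') \<otimes> ?r [^] i"
      using r int_pow_mult[OF r, of "- int i'" "int i"] by (simp add: k_def int_pow_neg int_pow_int)
    \<comment> \<open>\<open>z\<close> collects the difference of the right factors. Applying
      \<open>f\<close> removes \<open>t\<close> and \<open>t'\<close>, leaving
      \<open>f (?r [^] k) = f z\<close>, which is trivial or \<open>f (\<rho> 1)\<close>.\<close>
    define z where "z = s' \<otimes> inv s"
    have z: "z \<in> ?D"
      unfolding z_def using m generate_m_inv_closed[of "{\<rho> 1, \<rho> 2}" s] by (auto intro: generate.eng)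
    have zc: "z \<in> carrier G" using z Dc by blast
    have "t \<otimes> ?r [^] i = t' \<otimes> ?r [^] i' \<otimes> z"
      using eq c r unfolding z_def by (metis inv_solve_right m_assoc m_closed nat_pow_closed inv_closed)
    then have "f (t \<otimes> ?r [^] i) = f (t' \<otimes> ?r [^] i' \<otimes> z)" by simp
    then have "f (?r [^] i) = f (?r [^] i') \<otimes>\<^bsub>A\<^esub> f z"
      using c r zc f_T[OF m(1)] f_T[OF m(2)] by simp
    then have "f (?r [^] k) = f z"
      unfolding rk using r zc by (simp add: f.H.inv_solve_left')
    moreover have "?r [^] k \<in> generate G {\<rho> 0, \<rho> 1}"
      using subgroup_int_pow_closed[OF generate_is_subgroup, of "{\<rho> 0, \<rho> 1}" ?r k]
      by (auto intro: generate.incl generate.eng)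
    ultimately have "?r [^] k = \<one> \<or> ?r [^] k = \<rho> 1"
      using f_generate_12[OF z] f_faithful_01 by metis
    moreover have "?r [^] k \<noteq> \<rho> 1"
      using reflection_not_rotation[of "\<rho> 0" "\<rho> 1" k] ord_gt_2D[OF r] ord_gt_2 by auto
    ultimately have "?r [^] i = ?r [^] i'"
      using rk r by (metis inv_closed inv_equality inv_inv nat_pow_closed)
    then have ii: "i = i'"
      using ord_inj[OF r] m unfolding inj_on_def by fastforce
    have "t \<otimes> ?r [^] i = t' \<otimes> ?r [^] i \<otimes> z"
      using \<open>t \<otimes> ?r [^] i = t' \<otimes> ?r [^] i' \<otimes> z\<close> ii by simp
    \<comment> \<open>\<open>f\<close> cannot detect \<open>\<rho> 2\<close>; with equal exponents
      \<open>g\<close>, faithful on \<open>?D\<close>, forces \<open>z\<close> to be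
      trivial.\<close>
    then have "g (t \<otimes> ?r [^] i) = g (t' \<otimes> ?r [^] i \<otimes> z)" by simp
    then have "g (?r [^] i) = g (?r [^] i) \<otimes>\<^bsub>B\<^esub> g z"
      using c r zc g_T[OF m(1)] g_T[OF m(2)] by simp
    then have "g z = \<one>\<^bsub>B\<^esub>" using r zc by (metis g.H.r_cancel_one' g.H.l_cancel_one' g.hom_closed nat_pow_closed)
    then have "z = \<one>" using g_faithful_12[OF z] by simp
    then have "s = s'" unfolding z_def using c by (metis inv_equality inv_inv inv_closed)
    moreover have "t = t'"
      using eq ii \<open>s = s'\<close> c r by simp
    ultimately show "x = y" using e ii by simp
  qed
  ultimately have "card (carrier G) = card ?S" "finite (carrier G)"
    using T_finite D(2) by (simp_all add: card_image)
  then show "order G = 2 * ord (\<rho> 0 \<otimes> \<rho> 1) * ord (\<rho> 1 \<otimes> \<rho> 2) * card T" "finite (carrier G)"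
    by (simp_all add: order_def card_cartesian_product D[simplified])
qed

end

section \<open>Transfer to the natural numbers\<close>

text \<open>The final statement asks for a group on \<open>nat\<close>; a finite carrier embeds
  there and the structure is transported along the embedding.\<close>

lemma string_C_group_transfer_nat:
  fixes G (structure)
  assumes "string_C_group_rank3 G \<rho>" and fin: "finite (carrier G)"
  shows "\<exists>(H :: nat monoid) \<sigma>. string_C_group_rank3 H \<sigma> \<and> order H = order G \<and>
    schlaefli_type H \<sigma> = schlaefli_type G \<rho>"
proof -
  interpret string_C_group_rank3 G \<rho> by fact
  obtain \<phi> :: "'a \<Rightarrow> nat" where inj: "inj_on \<phi> (carrier G)"
    using finite_imp_inj_to_nat_seg[OF fin] by blast
  define \<psi> where "\<psi> = inv_into (carrier G) \<phi>"
  have \<psi>: "\<psi> (\<phi> x) = x" if "x \<in> carrier G" for x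
    using that inj by (simp add: \<psi>_def)
  define H where "H = \<lparr>carrier = \<phi> ` carrier G, monoid.mult = (\<lambda>x y. \<phi> (\<psi> x \<otimes> \<psi> y)), one = \<phi> \<one>\<rparr>"
  define \<sigma> where "\<sigma> = \<phi> \<circ> \<rho>"
  have H: "carrier H = \<phi> ` carrier G" "\<one>\<^bsub>H\<^esub> = \<phi> \<one>" by (simp_all add: H_def)
  have mult: "\<phi> x \<otimes>\<^bsub>H\<^esub> \<phi> y = \<phi> (x \<otimes> y)" if "x \<in> carrier G" "y \<in> carrier G" for x y
    using that \<psi> by (simp add: H_def)
  have "group H"
  proof (rule groupI)
    fix x assume "x \<in> carrier H"
    then obtain u where u: "u \<in> carrier G" "x = \<phi> u" using H by auto
    then have "\<phi> (inv u) \<otimes>\<^bsub>H\<^esub> x = \<one>\<^bsub>H\<^esub>" "\<phi> (inv u) \<in> carrier H" using H mult by simp_all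
    then show "\<exists>y\<in>carrier H. y \<otimes>\<^bsub>H\<^esub> x = \<one>\<^bsub>H\<^esub>" by blast
  qed (auto simp: H mult m_assoc)
  moreover have "\<phi> \<in> hom G H" using H mult by (auto intro: homI)
  ultimately interpret \<phi>: group_hom G H \<phi>
    by (simp add: group_hom_def group_hom_axioms_def group_axioms)
  have gen: "generate H (\<sigma> ` I) = \<phi> ` generate G (\<rho> ` I)" if "I \<subseteq> {0, 1, 2}" for I
  proof -
    have "\<rho> ` I \<subseteq> carrier G" using that rho_closed by blast
    then show ?thesis using \<phi>.generate_img[of "\<rho> ` I"] by (simp add: \<sigma>_def image_image)
  qed
  have sub: "generate G (\<rho> ` I) \<subseteq> carrier G" if "I \<subseteq> {0, 1, 2}" for I
    using that rho_closed by (intro generate_incl) blast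
  have ord: "group.ord H (\<phi> x) = ord x" if "x \<in> carrier G" for x
  proof (subst \<phi>.H.ord_unique)
    show "\<forall>n. \<phi> x [^]\<^bsub>H\<^esub> n = \<one>\<^bsub>H\<^esub> \<longleftrightarrow> ord x dvd n"
    proof
      fix n :: nat
      have "\<phi> x [^]\<^bsub>H\<^esub> n = \<one>\<^bsub>H\<^esub> \<longleftrightarrow> \<phi> (x [^] n) = \<phi> \<one>"
        using that by (simp add: \<phi>.hom_nat_pow)
      also have "\<dots> \<longleftrightarrow> x [^] n = \<one>" using that inj by (auto simp: inj_on_def)
      finally show "\<phi> x [^]\<^bsub>H\<^esub> n = \<one>\<^bsub>H\<^esub> \<longleftrightarrow> ord x dvd n" using that by (simp add: pow_eq_id)
    qed
  qed (use that in simp)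
  have c: "\<rho> 0 \<in> carrier G" "\<rho> 1 \<in> carrier G" "\<rho> 2 \<in> carrier G" by (simp_all add: rho_closed)
  have "string_C_group_rank3 H \<sigma>"
  proof
    fix i :: nat assume i: "i \<in> {0, 1, 2}"
    have c: "\<rho> i \<in> carrier G" using i by (rule rho_closed)
    then show "\<sigma> i \<in> carrier H" by (simp add: \<sigma>_def)
    have "\<phi> (\<rho> i) \<noteq> \<phi> \<one>" using inj_onD[OF inj _ c one_closed] involution[OF i] by blast
    then show "\<sigma> i \<noteq> \<one>\<^bsub>H\<^esub> \<and> \<sigma> i \<otimes>\<^bsub>H\<^esub> \<sigma> i = \<one>\<^bsub>H\<^esub>"
      unfolding \<sigma>_def comp_def mult[OF c c] H(2) using involution[OF i] by simp
  next
    show "generate H (\<sigma> ` {0, 1, 2}) = carrier H"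
      using gen[of "{0, 1, 2}"] generated H by simp
  next
    show "\<sigma> 0 \<otimes>\<^bsub>H\<^esub> \<sigma> 2 = \<sigma> 2 \<otimes>\<^bsub>H\<^esub> \<sigma> 0"
      unfolding \<sigma>_def comp_def mult[OF c(1,3)] mult[OF c(3,1)] string_property ..
  next
    fix I J :: "nat set" assume IJ: "I \<subseteq> {0, 1, 2}" "J \<subseteq> {0, 1, 2}"
    then have "I \<inter> J \<subseteq> {0, 1, 2}" by blast
    then show "generate H (\<sigma> ` I) \<inter> generate H (\<sigma> ` J) = generate H (\<sigma> ` (I \<inter> J))"
      unfolding gen[OF IJ(1)] gen[OF IJ(2)] gen[OF \<open>I \<inter> J \<subseteq> {0, 1, 2}\<close>]
      using inj_on_image_Int[OF inj sub[OF IJ(1)] sub[OF IJ(2)]] intersection_property[OF IJ] by simp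
  qed
  moreover have "order H = order G" using inj by (simp add: order_def H card_image)
  moreover have "schlaefli_type H \<sigma> = schlaefli_type G \<rho>"
  proof -
    have "group.ord H (\<sigma> 0 \<otimes>\<^bsub>H\<^esub> \<sigma> 1) = ord (\<rho> 0 \<otimes> \<rho> 1)"
      "group.ord H (\<sigma> 1 \<otimes>\<^bsub>H\<^esub> \<sigma> 2) = ord (\<rho> 1 \<otimes> \<rho> 2)"
      unfolding \<sigma>_def comp_def mult[OF c(1,2)] mult[OF c(2,3)] using ord c by blast+
    then show ?thesis unfolding schlaefli_type_def by blast
  qed
  ultimately show ?thesis by blast
qed

section \<open>Dihedral groups and torus maps acting on complex numbers\<close>

lemma (in group) normalI_involutions:
  assumes S: "S \<subseteq> carrier G" "\<forall>x\<in>S. x \<otimes> x = \<one>" and gen: "generate G S = carrier G"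
    and T: "subgroup T G" and conj: "\<And>s t. s \<in> S \<Longrightarrow> t \<in> T \<Longrightarrow> s \<otimes> t \<otimes> s \<in> T"
  shows "T \<lhd> G"
  unfolding normal_inv_iff
proof (intro conjI T ballI)
  fix x h assume x: "x \<in> carrier G" and h: "h \<in> T"
  have hc: "h \<in> carrier G" using T h by (rule subgroup.mem_carrier)
  have "x \<in> generate G S" using x gen by simp
  with S show "x \<otimes> h \<otimes> inv x \<in> T"
  proof (induction rule: generate_left_induct)
    case one
    then show ?case using h hc by simp
  next
    case (mult a y)
    have c: "a \<in> carrier G" "inv a = a" "y \<in> carrier G"
      using mult(1,2) S gen involution_inv by auto
    have "a \<otimes> (y \<otimes> h \<otimes> inv y) \<otimes> a \<in> T" using conj mult by blast
    then show ?case using c hc by (simp add: inv_mult_group m_assoc)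
  qed
qed

section \<open>Powers in direct products and permutation groups\<close>

lemma DirProd_pow:
  "(x, y) [^]\<^bsub>G \<times>\<times> H\<^esub> (n :: nat) = (x [^]\<^bsub>G\<^esub> n, y [^]\<^bsub>H\<^esub> n)"
  by (induction n) auto

text \<open>Plain functions on a whole type: products are ordinary compositions and powers are
  \<open>^^\<close>, so relations between generators become pointwise calculations.\<close>

definition bij_group :: "('a \<Rightarrow> 'a) monoid" where
  "bij_group = \<lparr>carrier = {f. bij f}, monoid.mult = (\<circ>), one = id\<rparr>"

lemma bij_group_simps [simp]:
  "carrier bij_group = {f. bij f}" "f \<otimes>\<^bsub>bij_group\<^esub> g = f \<circ> g" "\<one>\<^bsub>bij_group\<^esub> = id"
  by (simp_all add: bij_group_def)

lemma group_bij_group: "group bij_group"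
proof (rule groupI)
  fix f :: "'a \<Rightarrow> 'a" assume "f \<in> carrier bij_group"
  then show "\<exists>g\<in>carrier bij_group. g \<otimes>\<^bsub>bij_group\<^esub> f = \<one>\<^bsub>bij_group\<^esub>"
    by (intro bexI[of _ "inv_into UNIV f"]) (simp_all add: bij_imp_bij_inv bij_is_inj)
qed (auto simp: bij_comp)

lemma bij_group_pow: "f [^]\<^bsub>bij_group\<^esub> (n :: nat) = f ^^ n"
  by (induction n) (simp_all add: funpow_swap1 comp_def fun_eq_iff)

lemma involution_bij: "f \<circ> f = id \<Longrightarrow> bij f"
  by (rule o_bij)

section \<open>Complex roots of unity with integer exponents\<close>

definition root_of_unity :: "nat \<Rightarrow> int \<Rightarrow> complex" where
  "root_of_unity n k = cis (2 * pi * k / n)"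

lemma root_of_unity_eq_1_iff:
  assumes "n > 0"
  shows "root_of_unity n k = 1 \<longleftrightarrow> int n dvd k"
proof
  assume "root_of_unity n k = 1"
  then have "cos (2 * pi * k / n) = 1" by (simp add: root_of_unity_def complex_eq_iff)
  then obtain m :: int where "2 * pi * k / n = m * 2 * pi" by (auto simp: cos_one_2pi_int)
  then have "real_of_int k = real_of_int (m * int n)" using assms by (simp add: field_simps)
  then have "k = m * int n" by (simp only: of_int_eq_iff)
  then show "int n dvd k" by simp
next
  assume "int n dvd k"
  then obtain m where "k = int n * m" by blast
  then have "2 * pi * k / n = 2 * pi * of_int m" using assms by simp
  then show "root_of_unity n k = 1" by (simp only: root_of_unity_def cis_multiple_2pi Ints_of_int)
qed

lemma root_of_unity_nonzero [simp]: "root_of_unity n k \<noteq> 0"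
  by (simp add: root_of_unity_def)

lemma root_of_unity_0 [simp]: "root_of_unity n 0 = 1"
  by (simp add: root_of_unity_def)

lemma root_of_unity_add: "root_of_unity n (k + l) = root_of_unity n k * root_of_unity n l"
  by (simp add: root_of_unity_def cis_mult add_divide_distrib ring_distribs)

lemma cnj_root_of_unity [simp]: "cnj (root_of_unity n k) = root_of_unity n (- k)"
  by (simp add: root_of_unity_def cis_cnj)

lemma root_of_unity_mult_assoc [simp]:
  "root_of_unity n k * root_of_unity n l = root_of_unity n (k + l)"
  "root_of_unity n k * (root_of_unity n l * z) = root_of_unity n (k + l) * z"
  by (simp_all add: root_of_unity_add)

lemma root_of_unity_eq_iff:
  assumes "n > 0"
  shows "root_of_unity n k = root_of_unity n l \<longleftrightarrow> int n dvd k - l"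
proof -
  have "root_of_unity n k = root_of_unity n (k - l) * root_of_unity n l" by simp
  then have "root_of_unity n k = root_of_unity n l \<longleftrightarrow> root_of_unity n (k - l) = 1"
    by (metis mult_cancel_right1 root_of_unity_nonzero)
  then show ?thesis using root_of_unity_eq_1_iff[OF assms] by simp
qed

section \<open>The dihedral action on the complex plane\<close>

definition rotation :: "nat \<Rightarrow> int \<Rightarrow> complex \<Rightarrow> complex" where
  "rotation n k z = root_of_unity n k * z"

text \<open>For \<open>n > 0\<close> this is the reflection in the line through 0 at angle
  \<open>pi / n\<close>; together with \<open>cnj\<close> it generates the dihedral group of order
  \<open>2 * n\<close>.\<close>

definition reflection :: "nat \<Rightarrow> complex \<Rightarrow> complex" where
  "reflection n z = root_of_unity n 1 * cnj z"

lemma cnj_involution: "cnj \<circ> cnj = id"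
  by (simp add: fun_eq_iff)

lemma reflection_involution: "reflection n \<circ> reflection n = id"
  by (simp add: fun_eq_iff reflection_def)

lemma cnj_reflection: "cnj \<circ> reflection n = rotation n (- 1)"
  by (simp add: fun_eq_iff reflection_def rotation_def)

lemma reflection_cnj: "reflection n \<circ> cnj = rotation n 1"
  by (simp add: fun_eq_iff reflection_def rotation_def)

lemma rotation_funpow: "rotation n k ^^ m = rotation n (int m * k)"
  by (induction m) (simp_all add: fun_eq_iff rotation_def ring_distribs add.commute)

lemma rotation_eq_id_iff: "n > 0 \<Longrightarrow> rotation n k = id \<longleftrightarrow> int n dvd k"
proof -
  assume n: "n > 0"
  have "rotation n k = id \<longleftrightarrow> root_of_unity n k = 1"
    by (auto simp: fun_eq_iff rotation_def dest: spec[of _ 1])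
  then show ?thesis using root_of_unity_eq_1_iff[OF n] by simp
qed

text \<open>The first two coordinates \<open>z, w\<close> carry the action of the group of the toroidal map \<open>{4,4}\<close> with
  parameters \<open>(2 A, 0)\<close>; the other two transform like \<open>z w\<close> and \<open>z cnj w\<close>, which gives the one with
  parameters \<open>(B, B)\<close>.  Both are combined so that the translation subgroup below can have order
  \<open>A B\<close> with \<open>B = A\<close> or \<open>B = 2 A\<close>, that is, any power of \<open>2\<close>.\<close>

type_synonym complex4 = "complex \<times> complex \<times> complex \<times> complex"

fun torus0 :: "complex4 \<Rightarrow> complex4" where
  "torus0 (z, w, u, v) = (cnj z, w, cnj v, cnj u)"

fun torus1 :: "complex4 \<Rightarrow> complex4" where
  "torus1 (z, w, u, v) = (w, z, u, cnj v)"

text \<open>Replacing \<open>w\<close> by \<open>root_of_unity (2 * A) 1 * cnj w\<close> exchanges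
  \<open>z w\<close> and \<open>z cnj w\<close> up to inverse factors; \<open>u\<close> and
  \<open>v\<close> copy this with \<open>B\<close> in place of \<open>A\<close>.\<close>

fun torus2 :: "nat \<Rightarrow> nat \<Rightarrow> complex4 \<Rightarrow> complex4" where
  "torus2 A B (z, w, u, v) = (z, root_of_unity (2 * A) 1 * cnj w,
    root_of_unity (2 * B) 1 * v, root_of_unity (2 * B) (- 1) * u)"

fun translation :: "nat \<Rightarrow> nat \<Rightarrow> int \<Rightarrow> int \<Rightarrow> complex4 \<Rightarrow> complex4" where
  "translation A B k l (z, w, u, v) = (root_of_unity A k * z, root_of_unity A l * w,
    root_of_unity B (k + l) * u, root_of_unity B (k - l) * v)"

lemma torus_involutions:
  "torus0 \<circ> torus0 = id" "torus1 \<circ> torus1 = id" "torus2 A B \<circ> torus2 A B = id"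
  by (simp_all add: fun_eq_iff)

lemma torus_string: "torus0 \<circ> torus2 A B = torus2 A B \<circ> torus0"
  by (simp add: fun_eq_iff)

text \<open>The exponent 4 reflects the map type {4,4}; it lets the torus component leave orders
  divisible by 4 unchanged.\<close>

lemma torus_orders: "(torus0 \<circ> torus1) ^^ 4 = id" "(torus1 \<circ> torus2 A B) ^^ 4 = id"
  by (simp_all add: fun_eq_iff eval_nat_numeral)

lemma root_of_unity_double: "root_of_unity (2 * n) (2 * k) = root_of_unity n k"
  by (simp add: root_of_unity_def mult.assoc)

text \<open>The word \<open>\<rho> 0 \<rho> 1 \<rho> 2 \<rho> 1\<close> acts diagonally by roots of
  order \<open>2 * A\<close> and \<open>2 * B\<close>; squaring doubles the exponents, which yields
  roots of order \<open>A\<close> and \<open>B\<close>.\<close>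

lemma torus_translation:
  "torus0 \<circ> torus1 \<circ> torus2 A B \<circ> torus1 \<circ> (torus0 \<circ> torus1 \<circ> torus2 A B \<circ> torus1) = translation A B (- 1) 0"
  using root_of_unity_double[of A "- 1"] root_of_unity_double[of B "- 1"]
  by (simp add: fun_eq_iff)

lemma translation_add: "translation A B k l \<circ> translation A B k' l' = translation A B (k + k') (l + l')"
  by (simp add: fun_eq_iff algebra_simps)

lemma translation_0: "translation A B 0 0 = id"
  by (simp add: fun_eq_iff)

lemma translation_conj:
  "torus0 \<circ> translation A B k l \<circ> torus0 = translation A B (- k) l"
  "torus1 \<circ> translation A B k l \<circ> torus1 = translation A B l k"
  "torus2 A B \<circ> translation A B k l \<circ> torus2 A B = translation A B k (- l)"
proof -
  \<comment> \<open>Here roots of order \<open>A\<close> and \<open>2 * A\<close>, and of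
    \<open>B\<close> and \<open>2 * B\<close>, meet; expressing all by the doubled orders lets
    exponents be added.\<close>
  show "torus2 A B \<circ> translation A B k l \<circ> torus2 A B = translation A B k (- l)"
    using root_of_unity_double[of A l, symmetric] root_of_unity_double[of A "- l", symmetric]
      root_of_unity_double[of B "k + l", symmetric] root_of_unity_double[of B "k - l", symmetric]
    by (simp add: fun_eq_iff)
qed (simp_all add: fun_eq_iff add.commute)

lemma translation_eq_iff:
  assumes "A > 0" "B > 0"
  shows "translation A B k l = translation A B k' l' \<longleftrightarrow>
    int A dvd k - k' \<and> int A dvd l - l' \<and>
    int B dvd (k + l) - (k' + l') \<and> int B dvd (k - l) - (k' - l')" (is "?l \<longleftrightarrow> ?r")
proof -
  have "?l \<longleftrightarrow> root_of_unity A k = root_of_unity A k' \<and> root_of_unity A l = root_of_unity A l' \<and>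
    root_of_unity B (k + l) = root_of_unity B (k' + l') \<and>
    root_of_unity B (k - l) = root_of_unity B (k' - l')"
  proof
    assume ?l
    then have "translation A B k l (1, 1, 1, 1) = translation A B k' l' (1, 1, 1, 1)" by simp
    then show "root_of_unity A k = root_of_unity A k' \<and> root_of_unity A l = root_of_unity A l' \<and>
      root_of_unity B (k + l) = root_of_unity B (k' + l') \<and>
      root_of_unity B (k - l) = root_of_unity B (k' - l')" by simp
  qed (simp add: fun_eq_iff)
  then show ?thesis using root_of_unity_eq_iff assms by simp
qed

text \<open>The pairs acting trivially form \<open>A\<close> times the integer lattice if
  \<open>B = A\<close>, and \<open>A\<close> times the pairs with even sum if
  \<open>B = 2 * A\<close>; the index is \<open>A * B\<close> in both cases.\<close>

lemma card_translations:
  assumes A: "A > 0" and B: "B = A \<or> B = 2 * A"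
  shows "card (range (\<lambda>(k, l). translation A B k l)) = A * B"
    and "finite (range (\<lambda>(k, l). translation A B k l))"
proof -
  let ?t = "\<lambda>(k, l). translation A B k l"
  let ?S = "{0..<int B} \<times> {0..<int A}"
  have B0: "B > 0" using assms by auto
  have AB: "int A dvd int B" using B by auto
  have "range ?t = ?t ` ?S"
  proof (intro equalityI subsetI)
    fix x assume "x \<in> range ?t"
    then obtain k l where x: "x = translation A B k l" by auto
    define q where "q = l div int A"
    \<comment> \<open>Lowering \<open>l\<close> by \<open>A * q\<close> is offset by raising
      \<open>k\<close> by \<open>A * q\<close>: the sum stays fixed and the difference changes by
      \<open>2 * A * q\<close>, a multiple of \<open>B\<close>.\<close>
    define k' where "k' = (k + int A * q) mod int B"
    define l' where "l' = l mod int A"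
    have l: "l - l' = int A * q" by (simp add: q_def l'_def minus_mod_eq_mult_div)
    have k: "int B dvd (k + int A * q) - k'" by (simp add: k'_def)
    then obtain m where "(k + int A * q) - k' = int B * m" by blast
    then have m: "k - k' = int B * m - int A * q" by simp
    have "translation A B k l = translation A B k' l'"
      unfolding translation_eq_iff[OF A B0]
    proof (intro conjI)
      show "int A dvd k - k'" unfolding m using AB by (simp add: dvd_mult2)
      show "int A dvd l - l'" unfolding l by simp
      have "(k + l) - (k' + l') = int B * m" using m l by simp
      then show "int B dvd (k + l) - (k' + l')" by simp
      have "(k - l) - (k' - l') = int B * m - (2 * int A) * q" using m l by simp
      moreover have "int B dvd 2 * int A" using B by auto
      ultimately show "int B dvd (k - l) - (k' - l')" by simp
    qed
    moreover have "(k', l') \<in> ?S" using A B0 by (simp add: k'_def l'_def)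
    ultimately show "x \<in> ?t ` ?S" using x by (metis (no_types, lifting) image_eqI case_prod_conv)
  qed auto
  moreover have "inj_on ?t ?S"
  proof (rule inj_onI, clarify)
    fix k l k' l' assume m: "k \<in> {0..<int B}" "l \<in> {0..<int A}" "k' \<in> {0..<int B}" "l' \<in> {0..<int A}"
      and eq: "translation A B k l = translation A B k' l'"
    have d: "int A dvd l - l'" "int B dvd (k + l) - (k' + l')" using eq translation_eq_iff[OF A B0] by auto
    have "l mod int A = l' mod int A" using d(1) by (simp add: mod_eq_dvd_iff)
    then have l: "l = l'" using m by simp
    then have "k mod int B = k' mod int B" using d(2) by (simp add: mod_eq_dvd_iff)
    then show "k = k' \<and> l = l'" using m l by simp
  qed
  ultimately show "card (range ?t) = A * B" "finite (range ?t)"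
    by (simp_all add: card_image card_cartesian_product)
qed

section \<open>The mixed group\<close>

lemma funpow_eq_id_dvd:
  assumes "f ^^ m = id" "m dvd n"
  shows "f ^^ n = id"
proof -
  obtain k where "n = m * k" using assms(2) by blast
  then show ?thesis using assms(1) by (simp add: funpow_mult[symmetric])
qed

text \<open>Divisibility by 4 lets \<open>K\<close> and \<open>L\<close> absorb the orders of the
  other two components of the respective rotation.\<close>

lemma regular_polytope_exists:
  assumes A: "A > 0" and B: "B = A \<or> B = 2 * A"
    and K: "K > 0" "4 dvd K" and L: "L > 0" "4 dvd L"
  shows "\<exists>(G :: nat monoid) \<rho>. string_C_group_rank3 G \<rho> \<and>
    order G = 2 * K * L * (A * B) \<and> schlaefli_type G \<rho> = (K, L)"
proof -
  define U :: "((complex4 \<Rightarrow> complex4) \<times> (complex \<Rightarrow> complex) \<times> (complex \<Rightarrow> complex)) monoid"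
    where "U = bij_group \<times>\<times> (bij_group \<times>\<times> bij_group)"
  define \<rho> where "\<rho> = (\<lambda>i :: nat. if i = 0 then (torus0, cnj, id)
    else if i = 1 then (torus1, reflection K, reflection L) else (torus2 A B, id, cnj))"
  define S where "S = \<rho> ` {0, 1, 2}"
  define G where "G = subgroup_generated U S"
  have \<rho>: "\<rho> 0 = (torus0, cnj, id)" "\<rho> (Suc 0) = (torus1, reflection K, reflection L)"
    "\<rho> 2 = (torus2 A B, id, cnj)" by (simp_all add: \<rho>_def)
  have U_mult: "(x, y, z) \<otimes>\<^bsub>U\<^esub> (x', y', z') = (x \<circ> x', y \<circ> y', z \<circ> z')" for x y z x' y' z'
    by (simp add: U_def)
  have U_one: "\<one>\<^bsub>U\<^esub> = (id, id, id)" by (simp add: U_def)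
  have U_carrier: "carrier U = {f. bij f} \<times> {f. bij f} \<times> {f. bij f}" by (simp add: U_def)
  interpret U: group U unfolding U_def by (intro DirProd_group group_bij_group)
  have bij: "bij torus0" "bij torus1" "bij (torus2 A B)" "bij cnj" "bij (reflection n)" for n
    by (simp_all add: involution_bij torus_involutions cnj_involution reflection_involution)
  have S_U: "S \<subseteq> carrier U" by (auto simp: S_def \<rho> U_carrier bij)
  then have G_carrier: "carrier G = generate U S"
    by (simp add: G_def carrier_subgroup_generated Int_absorb1)
  have G_mult: "monoid.mult G = monoid.mult U" and G_one: "\<one>\<^bsub>G\<^esub> = (id, id, id)" by (simp_all add: G_def U_one)
  have mult: "(x, y, z) \<otimes>\<^bsub>G\<^esub> (x', y', z') = (x \<circ> x', y \<circ> y', z \<circ> z')" for x y z x' y' z'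
    by (simp add: G_mult U_mult)
  have pow: "(x, y, z) [^]\<^bsub>G\<^esub> n = (x ^^ n, y ^^ n, z ^^ n)" for x y z and n :: nat
    by (simp add: G_def U_def pow_subgroup_generated DirProd_pow bij_group_pow)
  interpret G: group G unfolding G_def by (rule U.group_subgroup_generated)
  have S_G: "S \<subseteq> carrier G" unfolding G_carrier by (auto intro: generate.incl)
  \<comment> \<open>Generation inside \<open>G\<close> must be matched with generation inside the
    ambient product \<open>U\<close>.\<close>
  have G_gen: "generate G S = carrier G"
    using U.generate_consistent[of S "generate U S"] S_G S_U U.generate_is_subgroup[OF S_U]
    by (simp add: G_def subgroup_generated_def Int_absorb1 G_carrier)
  have G_U: "x \<in> carrier G \<Longrightarrow> x \<in> carrier U" for x
    unfolding G_carrier using U.generate_in_carrier[OF S_U] .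

  interpret string_reflections G \<rho>
  proof
    show "\<rho> i \<in> carrier G" if "i \<in> {0, 1, 2}" for i using that S_G by (auto simp: S_def)
    show "\<rho> i \<otimes>\<^bsub>G\<^esub> \<rho> i = \<one>\<^bsub>G\<^esub>" if "i \<in> {0, 1, 2}" for i
      using that by (auto simp: \<rho> mult G_one torus_involutions cnj_involution reflection_involution)
    show "generate G (\<rho> ` {0, 1, 2}) = carrier G" using G_gen by (simp add: S_def)
    show "\<rho> 0 \<otimes>\<^bsub>G\<^esub> \<rho> 2 = \<rho> 2 \<otimes>\<^bsub>G\<^esub> \<rho> 0" by (simp add: \<rho> mult torus_string)
  qed

  have rot01: "\<rho> 0 \<otimes>\<^bsub>G\<^esub> \<rho> 1 = (torus0 \<circ> torus1, rotation K (- 1), reflection L)"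
    by (simp add: \<rho> mult cnj_reflection)
  have rot12: "\<rho> 1 \<otimes>\<^bsub>G\<^esub> \<rho> 2 = (torus1 \<circ> torus2 A B, reflection K, rotation L 1)"
    by (simp add: \<rho> mult reflection_cnj)
  have refl_pow: "reflection n ^^ 4 = id" for n
    by (simp add: fun_eq_iff reflection_def eval_nat_numeral)
  have ord01: "G.ord (\<rho> 0 \<otimes>\<^bsub>G\<^esub> \<rho> 1) = K"
  proof (subst G.ord_unique)
    show "\<forall>n. (\<rho> 0 \<otimes>\<^bsub>G\<^esub> \<rho> 1) [^]\<^bsub>G\<^esub> n = \<one>\<^bsub>G\<^esub> \<longleftrightarrow> K dvd n"
    proof
      fix n :: nat
      \<comment> \<open>The middle component alone decides when a power is trivial; the outer ones
        have fourth power \<open>id\<close>.\<close>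
      have "rotation K (- 1) ^^ n = id \<longleftrightarrow> K dvd n"
        using K(1) by (simp add: rotation_funpow rotation_eq_id_iff)
      moreover have "(torus0 \<circ> torus1) ^^ n = id \<and> reflection L ^^ n = id" if "K dvd n"
        using that K(2) torus_orders(1) refl_pow by (meson dvd_trans funpow_eq_id_dvd)
      ultimately show "(\<rho> 0 \<otimes>\<^bsub>G\<^esub> \<rho> 1) [^]\<^bsub>G\<^esub> n = \<one>\<^bsub>G\<^esub> \<longleftrightarrow> K dvd n"
        unfolding rot01 pow G_one by blast
    qed
  qed simp
  have ord12: "G.ord (\<rho> 1 \<otimes>\<^bsub>G\<^esub> \<rho> 2) = L"
  proof (subst G.ord_unique)
    show "\<forall>n. (\<rho> 1 \<otimes>\<^bsub>G\<^esub> \<rho> 2) [^]\<^bsub>G\<^esub> n = \<one>\<^bsub>G\<^esub> \<longleftrightarrow> L dvd n"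
    proof
      fix n :: nat
      have "rotation L 1 ^^ n = id \<longleftrightarrow> L dvd n"
        using L(1) by (simp add: rotation_funpow rotation_eq_id_iff)
      moreover have "(torus1 \<circ> torus2 A B) ^^ n = id \<and> reflection K ^^ n = id" if "L dvd n"
        using that L(2) torus_orders(2) refl_pow by (meson dvd_trans funpow_eq_id_dvd)
      ultimately show "(\<rho> 1 \<otimes>\<^bsub>G\<^esub> \<rho> 2) [^]\<^bsub>G\<^esub> n = \<one>\<^bsub>G\<^esub> \<longleftrightarrow> L dvd n"
        unfolding rot12 pow G_one by blast
    qed
  qed simp

  define f g where "f = (\<lambda>x :: (complex4 \<Rightarrow> complex4) \<times> (complex \<Rightarrow> complex) \<times> (complex \<Rightarrow> complex). fst (snd x))"
    and "g = (\<lambda>x :: (complex4 \<Rightarrow> complex4) \<times> (complex \<Rightarrow> complex) \<times> (complex \<Rightarrow> complex). snd (snd x))"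
  interpret bij: group "bij_group :: (complex \<Rightarrow> complex) monoid" by (rule group_bij_group)
  have f: "group_hom G bij_group f" and g: "group_hom G bij_group g"
    using G_U by (auto simp: group_hom_def group_hom_axioms_def G.is_group bij.is_group f_def g_def
        mult U_carrier intro!: homI)
  have ord_rot: "bij.ord (rotation n k) = n" if "n > 0" "k = 1 \<or> k = - 1" for n and k :: int
  proof (subst bij.ord_unique)
    have "rotation n k \<circ> rotation n (- k) = id" "rotation n (- k) \<circ> rotation n k = id"
      by (simp_all add: rotation_def fun_eq_iff)
    then show "rotation n k \<in> carrier bij_group" by (auto intro: o_bij)
    show "\<forall>m. rotation n k [^]\<^bsub>bij_group\<^esub> m = \<one>\<^bsub>bij_group\<^esub> \<longleftrightarrow> n dvd m"
      using that by (auto simp: bij_group_pow rotation_funpow rotation_eq_id_iff)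
  qed
  have ge: "K > 2" "L > 2" using K L by (auto dest!: dvd_imp_le)

  \<comment> \<open>All translations, with \<open>id\<close> in the dihedral coordinates, so that
    \<open>f\<close> and \<open>g\<close> are trivial on \<open>T\<close>.\<close>
  define T where "T = (\<lambda>(k, l). (translation A B k l, id :: complex \<Rightarrow> complex, id :: complex \<Rightarrow> complex)) ` UNIV"
  have T_mem: "(translation A B k l, id, id) \<in> T" for k l
    unfolding T_def by (metis (no_types, lifting) UNIV_I case_prod_conv image_eqI)
  have T_cases: "\<exists>k l. x = (translation A B k l, id, id)" if "x \<in> T" for x
    using that by (auto simp: T_def)
  have add: "(translation A B k l, id, id) \<otimes>\<^bsub>G\<^esub> (translation A B k' l', id, id) =
      (translation A B (k + k') (l + l'), id, id)" for k l k' l'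
    by (simp add: mult translation_add)
  have conj: "\<rho> 0 \<otimes>\<^bsub>G\<^esub> (translation A B k l, id, id) \<otimes>\<^bsub>G\<^esub> \<rho> 0 = (translation A B (- k) l, id, id)"
    "\<rho> 1 \<otimes>\<^bsub>G\<^esub> (translation A B k l, id, id) \<otimes>\<^bsub>G\<^esub> \<rho> 1 = (translation A B l k, id, id)"
    "\<rho> 2 \<otimes>\<^bsub>G\<^esub> (translation A B k l, id, id) \<otimes>\<^bsub>G\<^esub> \<rho> 2 = (translation A B k (- l), id, id)" for k l
    by (simp_all add: \<rho> mult translation_conj cnj_involution reflection_involution)
  have square: "(\<rho> 0 \<otimes>\<^bsub>G\<^esub> \<rho> 1 \<otimes>\<^bsub>G\<^esub> \<rho> 2 \<otimes>\<^bsub>G\<^esub> \<rho> 1) \<otimes>\<^bsub>G\<^esub> (\<rho> 0 \<otimes>\<^bsub>G\<^esub> \<rho> 1 \<otimes>\<^bsub>G\<^esub> \<rho> 2 \<otimes>\<^bsub>G\<^esub> \<rho> 1) =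
      (translation A B (- 1) 0, id, id)"
  proof -
    \<comment> \<open>In each dihedral coordinate one generator is \<open>id\<close>, and the word
      collapses to \<open>cnj\<close> or to a conjugate of it, an involution.\<close>
    have "cnj \<circ> reflection K \<circ> id \<circ> reflection K \<circ> (cnj \<circ> reflection K \<circ> id \<circ> reflection K) = id"
      "id \<circ> reflection L \<circ> cnj \<circ> reflection L \<circ> (id \<circ> reflection L \<circ> cnj \<circ> reflection L) = id"
      by (simp_all add: fun_eq_iff reflection_def)
    then show ?thesis using torus_translation[of A B] by (simp add: \<rho> mult)
  qed
  have T_G: "(translation A B k l, id, id) \<in> carrier G" for k l
  proof -
    let ?t = "\<lambda>k l. (translation A B k l, id, id)"
    \<comment> \<open>The square gives one unit step, conjugation by \<open>\<rho> 0\<close> its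
      inverse, and integer induction the first axis; conjugation by \<open>\<rho> 1\<close> carries
      this to the second axis.\<close>
    have m1: "?t (- 1) 0 \<in> carrier G" using square by (metis G.m_closed rho_in_carrier One_nat_def)
    have 1: "?t 1 0 \<in> carrier G" using conj(1)[of "- 1" 0] m1 by (metis G.m_closed rho_in_carrier(1) minus_minus)
    have step: "?t (k + 1) 0 \<in> carrier G" "?t (k - 1) 0 \<in> carrier G" if "?t k 0 \<in> carrier G" for k
      using G.m_closed[OF that 1] G.m_closed[OF that m1] unfolding add by simp_all
    have "?t 0 0 \<in> carrier G" using G.one_closed unfolding G_one translation_0 .
    then have x: "?t k 0 \<in> carrier G" for k
      using int_induct[of "\<lambda>k. ?t k 0 \<in> carrier G" 0 k] step by blast
    have "?t 0 l \<in> carrier G" using conj(2)[of l 0] x[of l] by (metis G.m_closed rho_in_carrier(2) One_nat_def)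
    from G.m_closed[OF x[of k] this] show ?thesis unfolding add by simp
  qed

  interpret tight_kernel G \<rho> bij_group f bij_group g T
  proof (intro tight_kernel.intro split_string_reflections.intro split_string_reflections_axioms.intro
      tight_kernel_axioms.intro f g string_reflections_axioms)
    show "f (\<rho> 2) = \<one>\<^bsub>bij_group\<^esub>" by (simp add: f_def \<rho>)
    have "cnj \<i> \<noteq> id \<i>" by (simp add: complex_eq_iff)
    then have "cnj \<noteq> id" by metis
    then show "\<rho> 2 \<noteq> \<one>\<^bsub>G\<^esub>" by (simp add: \<rho> G_one)
    show "bij.ord (f (\<rho> 0 \<otimes>\<^bsub>G\<^esub> \<rho> 1)) = G.ord (\<rho> 0 \<otimes>\<^bsub>G\<^esub> \<rho> 1)"
      unfolding ord01 unfolding rot01 f_def using ord_rot K by simp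
    show "bij.ord (g (\<rho> 1 \<otimes>\<^bsub>G\<^esub> \<rho> 2)) = G.ord (\<rho> 1 \<otimes>\<^bsub>G\<^esub> \<rho> 2)"
      unfolding ord12 unfolding rot12 g_def using ord_rot L by simp
    show "2 < G.ord (\<rho> 0 \<otimes>\<^bsub>G\<^esub> \<rho> 1)" "2 < G.ord (\<rho> 1 \<otimes>\<^bsub>G\<^esub> \<rho> 2)" using ge ord01 ord12 by simp_all
    show "f x = \<one>\<^bsub>bij_group\<^esub>" "g x = \<one>\<^bsub>bij_group\<^esub>" if "x \<in> T" for x
      using T_cases[OF that] by (auto simp: f_def g_def)
    show "\<rho> 0 \<otimes>\<^bsub>G\<^esub> \<rho> 1 \<otimes>\<^bsub>G\<^esub> \<rho> 2 \<otimes>\<^bsub>G\<^esub> \<rho> 1 \<otimes>\<^bsub>G\<^esub> (\<rho> 0 \<otimes>\<^bsub>G\<^esub> \<rho> 1 \<otimes>\<^bsub>G\<^esub> \<rho> 2 \<otimes>\<^bsub>G\<^esub> \<rho> 1) \<in> T"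
      unfolding square by (rule T_mem)
    have "T = (\<lambda>x. (x, id, id)) ` range (\<lambda>(k, l). translation A B k l)"
      by (auto simp: T_def image_image split_def)
    then show "finite T" using card_translations(2)[OF A B] by simp
    show "T \<lhd> G"
    proof (rule G.normalI_involutions[of S])
      show "S \<subseteq> carrier G" "generate G S = carrier G" by (fact S_G G_gen)+
      show "\<forall>x\<in>S. x \<otimes>\<^bsub>G\<^esub> x = \<one>\<^bsub>G\<^esub>" by (auto simp: S_def)
      show "subgroup T G"
      proof (rule G.subgroupI)
        show "T \<subseteq> carrier G" using T_cases T_G by blast
        show "T \<noteq> {}" using T_mem by blast
        fix x assume "x \<in> T"
        then obtain k l where x: "x = (translation A B k l, id, id)" using T_cases by blast
        have "inv\<^bsub>G\<^esub> x = (translation A B (- k) (- l), id, id)"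
          unfolding x by (rule G.inv_equality) (simp_all add: add T_G, simp add: G_one translation_0)
        then show "inv\<^bsub>G\<^esub> x \<in> T" using T_mem by simp
        fix y assume "y \<in> T"
        then obtain k' l' where y: "y = (translation A B k' l', id, id)" using T_cases by blast
        show "x \<otimes>\<^bsub>G\<^esub> y \<in> T" unfolding x y add by (rule T_mem)
      qed
      show "s \<otimes>\<^bsub>G\<^esub> t \<otimes>\<^bsub>G\<^esub> s \<in> T" if s: "s \<in> S" and t: "t \<in> T" for s t
      proof -
        obtain k l where t: "t = (translation A B k l, id, id)" using t T_cases by blast
        have "s = \<rho> 0 \<or> s = \<rho> 1 \<or> s = \<rho> 2" using s by (auto simp: S_def)
        then show ?thesis unfolding t using conj[of k l] T_mem by metis
      qed
    qed
  qed

  have "card T = A * B"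
  proof -
    have "T = (\<lambda>x. (x, id, id)) ` range (\<lambda>(k, l). translation A B k l)"
      by (auto simp: T_def image_image split_def)
    then have "card T = card (range (\<lambda>(k, l). translation A B k l))"
      by (simp add: card_image inj_on_def)
    then show ?thesis using card_translations(1)[OF A B] by simp
  qed
  then have "order G = 2 * K * L * (A * B)" using order ord01 ord12 by simp
  moreover have "schlaefli_type G \<rho> = (K, L)" unfolding schlaefli_type_def ord01 ord12 ..
  ultimately show ?thesis
    using string_C_group_transfer_nat[OF string_C_group finite_carrier] by simp
qed

theorem corollary4p2:
  fixes p n s t :: nat
  assumes "Factorial_Ring.prime p" and "odd p"
    and "n > 0" and "s > 0" and "t > 0"
    and "s \<ge> 2" and "t \<ge> 2" and "n \<ge> s + t + 1"
  shows "\<exists>(G :: nat monoid) \<rho>. string_C_group_rank3 G \<rho> \<and>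
           Coset.order G = 2 ^ n * p \<and> schlaefli_type G \<rho> = (2 ^ s * p, 2 ^ t)"
proof -
  \<comment> \<open>The exponent of 2 left for the translation subgroup;
    \<open>n \<ge> s + t + 1\<close> keeps the natural subtraction exact.\<close>
  define j where "j = n - (s + t + 1)"
  \<comment> \<open>Splitting \<open>j\<close> into nearly equal halves, with the odd unit in
    \<open>b\<close>, makes \<open>2 ^ b\<close> equal to \<open>2 ^ a\<close> or twice that, as
    required of \<open>A\<close> and \<open>B\<close>.\<close>
  define a b where "a = j div 2" and "b = j - j div 2"
  have "b = a \<or> b = Suc a" unfolding a_def b_def by presburger
  then have B: "(2 :: nat) ^ b = 2 ^ a \<or> (2 :: nat) ^ b = 2 * 2 ^ a" by auto
  have four: "(4 :: nat) dvd 2 ^ m" if "m \<ge> 2" for m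
    using le_imp_power_dvd[OF that, of "2 :: nat"] by simp
  have "n = Suc (s + t + (a + b))" using assms(8) by (simp add: a_def b_def j_def)
  then have eq: "2 * (2 ^ s * p) * 2 ^ t * (2 ^ a * 2 ^ b) = 2 ^ n * p" by (simp add: power_add)
  show ?thesis
    unfolding eq[symmetric]
    by (rule regular_polytope_exists) (use B four assms prime_gt_0_nat in auto)
qed

end
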